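(* Let $A=(a_\alpha)_{\alpha\in\{0,1\}^d}$ be a $d$-dimensional $(0,1)$-matrix of order $2$ and let $f:\{0,1\}^d\to\{0,1\}$, $f(\alpha)=a_\alpha$, be the corresponding Boolean function. Then $A$ is an extremal matrix if and only if $f$ is a selfdual threshold Boolean function.
   Context: A $d$-dimensional $(0,1)$-matrix of order $n$ is an array $(a_\alpha)$, $a_\alpha\in\{0,1\}$, indexed by $\alpha=(\alpha_1,\ldots,\alpha_d)$ with $\alpha_i\in\{0,\ldots,n-1\}$. Its support is the set of $\alpha$ with $a_\alpha=1$. The hyperplanes are the sets $\Gamma_{i,j}=\{\alpha:\alpha_i=j\}$, $1\le i\le d$, $0\le j\le n-1$. A polydiagonal in $A$ is an assignment of nonnegative real weights to the entries of the support of $A$ such that the sum of the weights over each hyperplane equals $1$. The matrix $A$ is extremal if $A$ has no polydiagonal, and after adding any new index to the support of $A$ the resulting matrix has a polydiagonal. A Boolean function $f:\{0,1\}^d\to\{0,1\}$ is threshold if there are real weights $\mu_1,\ldots,\mu_d$ and a real threshold $T$ such that $f(x_1,\ldots,x_d)=1\iff\sum_{i=1}^d\mu_i x_i\ge T$. It is selfdual if $f(x)=1-f(\overline{x})$ for all $x$, where $\overline{x}=(1-x_1,\ldots,1-x_d)$. *)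

theory Defs
  imports "HOL-Analysis.Analysis"
begin

text \<open>The dimension is \<open>d = CARD('d)\<close>: the coordinates are labelled by an arbitrary finite type
  \<open>'d\<close> instead of \<open>{1, \<dots>, d}\<close>. Matrices are total functions on \<open>'d \<Rightarrow> nat\<close>;
  only their values on \<open>index_set n\<close> matter.\<close>

definition index_set :: "nat \<Rightarrow> ('d::finite \<Rightarrow> nat) set" where
  "index_set n = {\<alpha>. \<forall>i. \<alpha> i \<in> {0..<n}}"

definition zero_one_matrix :: "nat \<Rightarrow> (('d::finite \<Rightarrow> nat) \<Rightarrow> nat) \<Rightarrow> bool" where
  "zero_one_matrix n A \<longleftrightarrow> A \<in> index_set n \<rightarrow> {0, 1}"

definition matrix_support :: "nat \<Rightarrow> (('d::finite \<Rightarrow> nat) \<Rightarrow> nat) \<Rightarrow> ('d \<Rightarrow> nat) set" where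
  "matrix_support n A = {\<alpha> \<in> index_set n. A \<alpha> = 1}"

definition matrix_hyperplane :: "nat \<Rightarrow> 'd::finite \<Rightarrow> nat \<Rightarrow> ('d \<Rightarrow> nat) set" where
  "matrix_hyperplane n i j = {\<alpha> \<in> index_set n. \<alpha> i = j}"

text \<open>A polydiagonal carries weights on the support only: values of \<open>w\<close> elsewhere are
  ignored. The sums range over finite sets by \<open>finite_index_set\<close>.\<close>

definition polydiagonal ::
  "nat \<Rightarrow> (('d::finite \<Rightarrow> nat) \<Rightarrow> nat) \<Rightarrow> (('d \<Rightarrow> nat) \<Rightarrow> real) \<Rightarrow> bool" where
  "polydiagonal n A w \<longleftrightarrow>
     (\<forall>\<alpha> \<in> matrix_support n A. w \<alpha> \<ge> 0) \<and>
     (\<forall>i. \<forall>j \<in> {0..<n}. (\<Sum>\<alpha> \<in> matrix_hyperplane n i j \<inter> matrix_support n A. w \<alpha>) = 1)"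

definition extremal :: "nat \<Rightarrow> (('d::finite \<Rightarrow> nat) \<Rightarrow> nat) \<Rightarrow> bool" where
  "extremal n A \<longleftrightarrow>
     \<not> (\<exists>w. polydiagonal n A w) \<and>
     (\<forall>\<alpha> \<in> index_set n - matrix_support n A. \<exists>w. polydiagonal n (A(\<alpha> := 1)) w)"

definition boolean_cube :: "('d::finite \<Rightarrow> nat) set" where
  "boolean_cube = {x. \<forall>i. x i \<in> {0, 1}}"

lemma finite_index_set: "finite (index_set n :: ('d::finite \<Rightarrow> nat) set)"
proof -
  have "index_set n = (UNIV :: 'd set) \<rightarrow>\<^sub>E {0..<n}"
    by (auto simp: index_set_def PiE_def)
  then show ?thesis by (simp add: finite_PiE)
qed

lemma index_set_2: "index_set 2 = boolean_cube"
  by (auto simp: index_set_def boolean_cube_def less_2_cases_iff)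

definition threshold :: "(('d::finite \<Rightarrow> nat) \<Rightarrow> nat) \<Rightarrow> bool" where
  "threshold f \<longleftrightarrow>
     (\<exists>(\<mu> :: 'd \<Rightarrow> real) (T :: real). \<forall>x \<in> boolean_cube.
        f x = 1 \<longleftrightarrow> (\<Sum>i \<in> UNIV. \<mu> i * real (x i)) \<ge> T)"

text \<open>In the next two definitions the subtraction on \<open>nat\<close> does not truncate where it is
  used, since coordinates and values lie in \<open>{0, 1}\<close>.\<close>

definition complement :: "('d::finite \<Rightarrow> nat) \<Rightarrow> ('d \<Rightarrow> nat)" where
  "complement x = (\<lambda>i. 1 - x i)"

definition selfdual :: "(('d::finite \<Rightarrow> nat) \<Rightarrow> nat) \<Rightarrow> bool" where
  "selfdual f \<longleftrightarrow> (\<forall>x \<in> boolean_cube. f x = 1 - f (complement x))"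

end

theory Submission
  imports Defs
begin

text \<open>Identify \<open>{0,1}\<^sup>d\<close> with the sign vectors \<open>{-1,1}\<^sup>d\<close>. A polydiagonal of a matrix of
  order 2 is then, up to the factor 2, a representation of the origin as a convex combination of
  the sign vectors of the support. Hence a matrix without polydiagonals has a vector \<open>\<mu>\<close> that has a
  positive inner product with all these sign vectors; if the matrix is extremal, every other sign
  vector must have a negative inner product with \<open>\<mu>\<close>, and \<open>\<mu>\<close> witnesses both selfduality and the
  threshold property. Conversely, selfduality turns threshold weights into such a \<open>\<mu>\<close>, and a new
  index together with its complement carries a polydiagonal.\<close>

definition sign_vec :: "('d::finite \<Rightarrow> nat) \<Rightarrow> real ^ 'd" where
  "sign_vec \<alpha> = (\<chi> i. 2 * real (\<alpha> i) - 1)"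

lemma inj_sign_vec: "inj sign_vec"
  by (rule injI) (auto simp: sign_vec_def vec_eq_iff fun_eq_iff)

lemma boolean_cube_cases: "\<alpha> \<in> boolean_cube \<Longrightarrow> \<alpha> i = 0 \<or> \<alpha> i = 1"
  by (auto simp: boolean_cube_def)

lemma sign_vec_nonzero:
  assumes "\<alpha> \<in> boolean_cube"
  shows "sign_vec \<alpha> \<noteq> 0"
proof -
  have "sign_vec \<alpha> $ i \<noteq> 0" for i
    using boolean_cube_cases[OF assms, of i] by (auto simp: sign_vec_def)
  then show ?thesis
    by (metis zero_index)
qed

lemma complement_in_cube: "\<alpha> \<in> boolean_cube \<Longrightarrow> complement \<alpha> \<in> boolean_cube"
  by (auto simp: boolean_cube_def complement_def)

lemma sign_vec_complement:
  assumes "\<alpha> \<in> boolean_cube"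
  shows "sign_vec (complement \<alpha>) = - sign_vec \<alpha>"
proof -
  have "sign_vec (complement \<alpha>) $ i = (- sign_vec \<alpha>) $ i" for i
    using boolean_cube_cases[OF assms, of i] by (auto simp: sign_vec_def complement_def)
  then show ?thesis
    by (simp add: vec_eq_iff)
qed

text \<open>Translates threshold inequalities into inner products: cutting the linear form with
  weights \<open>\<mu>\<close> at half the total weight becomes a hyperplane through the
  origin.\<close>

lemma inner_sign_vec:
  "\<mu> \<bullet> sign_vec \<alpha> = 2 * (\<Sum>i\<in>UNIV. \<mu> $ i * real (\<alpha> i)) - (\<Sum>i\<in>UNIV. \<mu> $ i)"
  by (simp add: inner_vec_def sign_vec_def algebra_simps sum_subtractf sum_distrib_left)

lemma matrix_support_2: "matrix_support 2 A = {\<alpha> \<in> boolean_cube. A \<alpha> = 1}"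
  by (simp add: matrix_support_def index_set_2)

lemma finite_matrix_support: "finite (matrix_support n A)"
  by (simp add: matrix_support_def finite_index_set)

text \<open>For each direction, two hyperplane sums both equal 1 iff they add up to 2 and have
  difference 0. Their sum is the total weight, and their difference is one coordinate of the
  weighted sum of sign vectors.\<close>

lemma polydiagonal_2_iff:
  fixes A :: "('d::finite \<Rightarrow> nat) \<Rightarrow> nat"
  shows "polydiagonal 2 A w \<longleftrightarrow>
     (\<forall>\<alpha> \<in> matrix_support 2 A. 0 \<le> w \<alpha>) \<and>
     sum w (matrix_support 2 A) = 2 \<and>
     (\<Sum>\<alpha> \<in> matrix_support 2 A. w \<alpha> *\<^sub>R sign_vec \<alpha>) = 0"
proof -
  define S where "S = matrix_support 2 A"
  define h where "h i j = (\<Sum>\<alpha> \<in> matrix_hyperplane 2 i j \<inter> S. w \<alpha>)" for i j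
  have fin: "finite S"
    by (simp add: S_def finite_matrix_support)
  have cube: "\<alpha> i = 0 \<or> \<alpha> i = 1" if "\<alpha> \<in> S" for \<alpha> i
    using that by (auto simp: S_def matrix_support_2 boolean_cube_def)
  have h: "h i j = (\<Sum>\<alpha>\<in>S. if \<alpha> i = j then w \<alpha> else 0)" for i j
  proof -
    have "matrix_hyperplane 2 i j \<inter> S = {\<alpha> \<in> S. \<alpha> i = j}"
      by (auto simp: matrix_hyperplane_def S_def matrix_support_def)
    then show ?thesis
      using fin by (simp add: h_def sum.inter_filter)
  qed
  have total: "h i 0 + h i 1 = sum w S" for i
    unfolding h sum.distrib[symmetric] by (rule sum.cong) (use cube in force)+
  have diff: "h i 1 - h i 0 = (\<Sum>\<alpha>\<in>S. w \<alpha> *\<^sub>R sign_vec \<alpha>) $ i" for i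
    unfolding h sum_subtractf[symmetric] sum_component
    by (rule sum.cong) (use cube in \<open>force simp: sign_vec_def\<close>)+
  have eq: "(\<forall>j\<in>{0..<2}. h i j = 1) \<longleftrightarrow> sum w S = 2 \<and> (\<Sum>\<alpha>\<in>S. w \<alpha> *\<^sub>R sign_vec \<alpha>) $ i = 0" for i
  proof -
    have "(\<forall>j\<in>{0..<2}. h i j = 1) \<longleftrightarrow> h i 0 = 1 \<and> h i 1 = 1"
      by (auto simp: less_2_cases_iff)
    then show ?thesis
      using total[of i] diff[of i] by auto
  qed
  show ?thesis
    \<comment> \<open>The condition on the total weight does not depend on \<open>i\<close>; it
      leaves the quantifier because the type of coordinates is nonempty.\<close>
    unfolding polydiagonal_def S_def[symmetric] h_def[symmetric] eq vec_eq_iff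
    by auto
qed

text \<open>Opposite sign vectors cancel, so weight 1 on each of the two indices suffices.\<close>

lemma polydiagonal_2_pair:
  assumes "\<alpha> \<in> matrix_support 2 A" and "complement \<alpha> \<in> matrix_support 2 A"
  shows "\<exists>w. polydiagonal 2 A w"
proof -
  define w :: "_ \<Rightarrow> real" where "w = indicator {\<alpha>, complement \<alpha>}"
  have cube: "\<alpha> \<in> boolean_cube"
    using assms by (simp add: matrix_support_2)
  \<comment> \<open>\<open>undefined\<close> stands for an arbitrary coordinate; the two indices
    differ in every one.\<close>
  then have ne: "\<alpha> \<noteq> complement \<alpha>"
    using boolean_cube_cases[OF cube, of undefined]
    by (auto simp: complement_def dest: fun_cong[of _ _ undefined])
  have "sum w (matrix_support 2 A) = sum w {\<alpha>, complement \<alpha>}"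
    using assms by (intro sum.mono_neutral_right) (auto simp: w_def finite_matrix_support)
  moreover have "(\<Sum>\<beta> \<in> matrix_support 2 A. w \<beta> *\<^sub>R sign_vec \<beta>)
      = (\<Sum>\<beta> \<in> {\<alpha>, complement \<alpha>}. w \<beta> *\<^sub>R sign_vec \<beta>)"
    using assms by (intro sum.mono_neutral_right) (auto simp: w_def finite_matrix_support)
  ultimately have "polydiagonal 2 A w"
    using ne cube by (simp add: polydiagonal_2_iff sign_vec_complement w_def)
  then show ?thesis by blast
qed

text \<open>Gordan's alternative for the sign vectors of the support: either the origin lies in
  their convex hull, or some hyperplane through the origin has them all strictly on one
  side.\<close>

lemma no_polydiagonal_2_iff:
  fixes A :: "('d::finite \<Rightarrow> nat) \<Rightarrow> nat"
  shows "\<not> (\<exists>w. polydiagonal 2 A w) \<longleftrightarrow> (\<exists>\<mu>. \<forall>\<alpha> \<in> matrix_support 2 A. 0 < \<mu> \<bullet> sign_vec \<alpha>)"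
    (is "_ \<longleftrightarrow> ?separated")
proof
  define S where "S = matrix_support 2 A"
  define V where "V = sign_vec ` S"
  have fin: "finite V"
    by (simp add: V_def S_def finite_matrix_support)
  assume none: "\<not> (\<exists>w. polydiagonal 2 A w)"
  have "0 \<notin> convex hull V"
  proof
    assume "0 \<in> convex hull V"
    then obtain u where u: "\<forall>x\<in>V. 0 \<le> u x" "sum u V = 1" "(\<Sum>x\<in>V. u x *\<^sub>R x) = 0"
      using fin by (auto simp: convex_hull_finite)
    have inj: "inj_on sign_vec S"
      using inj_sign_vec by (rule inj_on_subset) simp
    \<comment> \<open>Convex coefficients add up to 1, the weights of a polydiagonal to 2.
      Injectivity of \<open>sign_vec\<close> moves the coefficients from vectors to indices.\<close>
    define w where "w \<alpha> = 2 * u (sign_vec \<alpha>)" for \<alpha>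
    have "sum w S = 2 * sum u V"
      by (simp add: w_def V_def sum.reindex[OF inj] sum_distrib_left)
    moreover have "(\<Sum>\<alpha>\<in>S. w \<alpha> *\<^sub>R sign_vec \<alpha>) = 2 *\<^sub>R (\<Sum>x\<in>V. u x *\<^sub>R x)"
      by (simp add: w_def V_def sum.reindex[OF inj] scaleR_sum_right)
    ultimately have "polydiagonal 2 A w"
      using u by (simp add: polydiagonal_2_iff S_def[symmetric] w_def V_def)
    with none show False by blast
  qed
  then obtain \<mu> b where "0 < b" "\<forall>x \<in> convex hull V. \<mu> \<bullet> x > b"
    using separating_hyperplane_closed_0[OF convex_convex_hull compact_imp_closed]
      finite_imp_compact_convex_hull[OF fin] by metis
  then show ?separated
    by (intro exI[of _ \<mu>]) (force simp: V_def S_def intro: hull_inc)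
next
  assume ?separated
  then obtain \<mu> where pos: "\<And>\<alpha>. \<alpha> \<in> matrix_support 2 A \<Longrightarrow> 0 < \<mu> \<bullet> sign_vec \<alpha>" by blast
  show "\<not> (\<exists>w. polydiagonal 2 A w)"
  proof
    assume "\<exists>w. polydiagonal 2 A w"
    then obtain w where w: "\<forall>\<alpha> \<in> matrix_support 2 A. 0 \<le> w \<alpha>"
      "sum w (matrix_support 2 A) = 2" "(\<Sum>\<alpha> \<in> matrix_support 2 A. w \<alpha> *\<^sub>R sign_vec \<alpha>) = 0"
      by (auto simp: polydiagonal_2_iff)
    \<comment> \<open>Pairing the balance equation with \<open>\<mu>\<close> leaves a vanishing sum
      of nonnegative terms, which forces every weight to be 0.\<close>
    have "(\<Sum>\<alpha> \<in> matrix_support 2 A. w \<alpha> * (\<mu> \<bullet> sign_vec \<alpha>)) = 0"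
      using arg_cong[OF w(3), of "inner \<mu>"] by (simp add: inner_sum_right)
    then have "\<forall>\<alpha> \<in> matrix_support 2 A. w \<alpha> * (\<mu> \<bullet> sign_vec \<alpha>) = 0"
      using w(1) pos by (subst (asm) sum_nonneg_eq_0_iff)
        (auto simp: finite_matrix_support less_imp_le)
    then have "\<forall>\<alpha> \<in> matrix_support 2 A. w \<alpha> = 0"
      using pos by fastforce
    with w(2) show False by simp
  qed
qed

text \<open>A nonnegative value at the new index would force all the weight onto it, but a single sign
  vector is not balanced.\<close>

lemma polydiagonal_2_new_index_neg:
  assumes pos: "\<forall>\<beta> \<in> matrix_support 2 A. 0 < \<mu> \<bullet> sign_vec \<beta>"
    and \<alpha>: "\<alpha> \<in> boolean_cube - matrix_support 2 A"
    and w: "polydiagonal 2 (A(\<alpha> := 1)) w"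
  shows "\<mu> \<bullet> sign_vec \<alpha> < 0"
proof (rule ccontr)
  assume "\<not> \<mu> \<bullet> sign_vec \<alpha> < 0"
  then have nonneg: "0 \<le> \<mu> \<bullet> sign_vec \<alpha>" by simp
  define S where "S = matrix_support 2 A"
  have fin: "finite S" by (simp add: S_def finite_matrix_support)
  have "\<alpha> \<notin> S" using \<alpha> by (simp add: S_def)
  have supp: "matrix_support 2 (A(\<alpha> := 1)) = insert \<alpha> S"
    using \<alpha> by (auto simp: S_def matrix_support_2)
  have w_nonneg: "\<forall>\<beta> \<in> insert \<alpha> S. 0 \<le> w \<beta>" and w_sum: "w \<alpha> + sum w S = 2"
    and w_zero: "w \<alpha> *\<^sub>R sign_vec \<alpha> + (\<Sum>\<beta>\<in>S. w \<beta> *\<^sub>R sign_vec \<beta>) = 0"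
    using w[unfolded polydiagonal_2_iff supp] fin \<open>\<alpha> \<notin> S\<close> by simp_all
  have terms: "\<forall>\<beta>\<in>S. 0 \<le> w \<beta> * (\<mu> \<bullet> sign_vec \<beta>)"
    using w_nonneg pos by (auto simp: S_def less_imp_le)
  have "w \<alpha> * (\<mu> \<bullet> sign_vec \<alpha>) + (\<Sum>\<beta>\<in>S. w \<beta> * (\<mu> \<bullet> sign_vec \<beta>)) = 0"
    using arg_cong[OF w_zero, of "inner \<mu>"] by (simp add: inner_sum_right inner_add_right)
  moreover have "0 \<le> w \<alpha> * (\<mu> \<bullet> sign_vec \<alpha>)"
    using w_nonneg nonneg by simp
  moreover have "0 \<le> (\<Sum>\<beta>\<in>S. w \<beta> * (\<mu> \<bullet> sign_vec \<beta>))"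
    using terms by (simp add: sum_nonneg)
  ultimately have "(\<Sum>\<beta>\<in>S. w \<beta> * (\<mu> \<bullet> sign_vec \<beta>)) = 0"
    by linarith
  then have "\<forall>\<beta>\<in>S. w \<beta> * (\<mu> \<bullet> sign_vec \<beta>) = 0"
    using terms fin by (simp add: sum_nonneg_eq_0_iff)
  then have "\<forall>\<beta>\<in>S. w \<beta> = 0"
    using pos by (fastforce simp: S_def)
  \<comment> \<open>All of the weight 2 now sits on \<open>\<alpha>\<close>, so
    \<open>w_zero\<close> would make its sign vector vanish.\<close>
  then show False
    using w_sum w_zero \<alpha> by (simp add: sign_vec_nonzero)
qed

theorem theorem7:
  fixes A f :: "('d::finite \<Rightarrow> nat) \<Rightarrow> nat"
  assumes "zero_one_matrix 2 A"
    and "f \<in> boolean_cube \<rightarrow> {0, 1}"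
    and "\<And>\<alpha>. \<alpha> \<in> boolean_cube \<Longrightarrow> f \<alpha> = A \<alpha>"
  shows "extremal 2 A \<longleftrightarrow> selfdual f \<and> threshold f"
proof
  have supp: "\<alpha> \<in> matrix_support 2 A \<longleftrightarrow> f \<alpha> = 1" if "\<alpha> \<in> boolean_cube" for \<alpha>
    using assms(3) that by (auto simp: matrix_support_2)
  have values_f: "f \<alpha> = 0 \<or> f \<alpha> = 1" if "\<alpha> \<in> boolean_cube" for \<alpha>
    using assms(2) that by auto
  {
    assume ext: "extremal 2 A"
    then obtain \<mu> where pos: "\<forall>\<alpha> \<in> matrix_support 2 A. 0 < \<mu> \<bullet> sign_vec \<alpha>"
      unfolding extremal_def no_polydiagonal_2_iff by blast
    have neg: "\<mu> \<bullet> sign_vec \<alpha> < 0" if "\<alpha> \<in> boolean_cube - matrix_support 2 A" for \<alpha>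
      using ext that polydiagonal_2_new_index_neg[OF pos that]
      by (auto simp: extremal_def index_set_2)
    \<comment> \<open>The inner product is never 0 on the cube, so its sign determines
      \<open>f\<close>. Complementation flips this sign, which yields selfduality.\<close>
    have one: "f \<alpha> = 1 \<longleftrightarrow> 0 < \<mu> \<bullet> sign_vec \<alpha>"
      and zero: "f \<alpha> = 0 \<longleftrightarrow> \<mu> \<bullet> sign_vec \<alpha> < 0" if "\<alpha> \<in> boolean_cube" for \<alpha>
      using pos neg[of \<alpha>] supp[OF that] values_f[OF that] that by force+
    have "f \<alpha> = 1 - f (complement \<alpha>)" if "\<alpha> \<in> boolean_cube" for \<alpha>
      using one[OF that] zero[OF that] values_f[OF that] one[OF complement_in_cube[OF that]]
        zero[OF complement_in_cube[OF that]] by (auto simp: sign_vec_complement[OF that])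
    \<comment> \<open>At half the total weight the inner product is 0; as this value is not
      attained, the strict and the weak inequality agree.\<close>
    moreover have "f \<alpha> = 1 \<longleftrightarrow> (\<Sum>i\<in>UNIV. \<mu> $ i * real (\<alpha> i)) \<ge> (\<Sum>i\<in>UNIV. \<mu> $ i) / 2"
      if "\<alpha> \<in> boolean_cube" for \<alpha>
      using one[OF that] zero[OF that] values_f[OF that] by (auto simp: inner_sign_vec)
    ultimately show "selfdual f \<and> threshold f"
      unfolding selfdual_def threshold_def by blast
  }
  {
    assume "selfdual f \<and> threshold f"
    then obtain m T where dual: "\<And>\<alpha>. \<alpha> \<in> boolean_cube \<Longrightarrow> f \<alpha> = 1 - f (complement \<alpha>)"
      and thr: "\<And>\<alpha>. \<alpha> \<in> boolean_cube \<Longrightarrow> f \<alpha> = 1 \<longleftrightarrow> (\<Sum>i\<in>UNIV. m i * real (\<alpha> i)) \<ge> T"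
      unfolding selfdual_def threshold_def by blast
    define \<mu> :: "real ^ 'd" where "\<mu> = (\<chi> i. m i)"
    have "0 < \<mu> \<bullet> sign_vec \<alpha>" if "\<alpha> \<in> matrix_support 2 A" for \<alpha>
    proof -
      have cube: "\<alpha> \<in> boolean_cube" using that by (simp add: matrix_support_2)
      note cube' = complement_in_cube[OF cube]
      have "f \<alpha> = 1" using supp[OF cube] that by simp
      then have "f (complement \<alpha>) \<noteq> 1" using dual[OF cube] by simp
      \<comment> \<open>The threshold \<open>T\<close> separates the linear form at
        \<open>\<alpha>\<close> from its value at the complement. The two inner products are
        opposite numbers, so the larger one is positive.\<close>
      then have "\<mu> \<bullet> sign_vec (complement \<alpha>) < \<mu> \<bullet> sign_vec \<alpha>"
        using thr[OF cube] thr[OF cube'] \<open>f \<alpha> = 1\<close> by (simp add: inner_sign_vec \<mu>_def)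
      then show ?thesis by (simp add: sign_vec_complement[OF cube])
    qed
    then have "\<not> (\<exists>w. polydiagonal 2 A w)"
      unfolding no_polydiagonal_2_iff by blast
    moreover have "\<exists>w. polydiagonal 2 (A(\<alpha> := 1)) w"
      if "\<alpha> \<in> index_set 2 - matrix_support 2 A" for \<alpha>
    proof (rule polydiagonal_2_pair)
      have cube: "\<alpha> \<in> boolean_cube" using that by (simp add: index_set_2)
      \<comment> \<open>Since \<open>f\<close> is 0 at the new index, selfduality puts the
        complement into the support already.\<close>
      have "f (complement \<alpha>) = 1"
        using dual[OF cube] values_f[OF complement_in_cube[OF cube]] supp[OF cube] that by auto
      then show "\<alpha> \<in> matrix_support 2 (A(\<alpha> := 1))"
        "complement \<alpha> \<in> matrix_support 2 (A(\<alpha> := 1))"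
        using cube complement_in_cube[OF cube] assms(3) by (auto simp: matrix_support_2)
    qed
    ultimately show "extremal 2 A"
      by (simp add: extremal_def)
  }
qed

end
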